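(* Let $A\in\mathbb{R}^{n_x\times n_x}$ and $B\in\mathbb{R}^{n_x\times n_u}$ be such that the system $\dot x = Ax+Bu$ is controllable, put $n_z=n_x+n_u$, and consider a Linear Ordinary Differential Equation Gaussian Process (LODE-GP) for this system, constructed with the squared exponential covariance function with parameters $\sigma_f>0$, $\ell>0$, having prior mean function $\mu:\mathbb{R}\to\mathbb{R}^{n_z}$ and matrix-valued covariance function $k$. Let $t_0\in\mathbb{R}$, $z_0\in\mathbb{R}^{n_z}$, let $\sigma_n^2\ge 0$ be the noise variance, and let $$\mu^*(t)=\mu(t)+k(t,t_0)\bigl(k(t_0,t_0)+\sigma_n^2 I\bigr)^{-1}\bigl(z_0-\mu(t_0)\bigr),\qquad t\in\mathbb{R},$$ be the posterior mean of this LODE-GP conditioned on the one-point dataset $\mathcal{D}=\{(t_0,z_0)\}$. Then the posterior mean converges to the prior mean as $t\to\pm\infty$, i.e. $$\lim_{t\to+\infty}\bigl(\mu^*(t)-\mu(t)\bigr)=0\quad\text{and}\quad \lim_{t\to-\infty}\bigl(\mu^*(t)-\mu(t)\bigr)=0 .$$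
   Context: State $x\in\mathbb{R}^{n_x}$ and control $u\in\mathbb{R}^{n_u}$ are stacked into $z=(x,u)\in\mathbb{R}^{n_z}$, $n_z=n_x+n_u$. The system $\dot x=Ax+Bu$ is rewritten as $Hz=0$, where $$H=\begin{pmatrix}A-\partial_t I & B\end{pmatrix}\in\mathbb{R}[\partial_t]^{n_x\times n_z}$$ is a matrix over the polynomial ring $\mathbb{R}[\partial_t]$ in the differentiation operator $\partial_t$. Smith normal form: there are invertible matrices $Q\in\mathbb{R}[\partial_t]^{n_x\times n_x}$ and $V\in\mathbb{R}[\partial_t]^{n_z\times n_z}$ (invertible over $\mathbb{R}[\partial_t]$) with $QHV=D$, where $D$ is the Smith normal form of $H$. Since the system is controllable, $D=\begin{pmatrix}I_{n_x}&0\end{pmatrix}$. Fix any such $Q,V$, and let $V_0\in\mathbb{R}[\partial_t]^{n_z\times n_u}$ consist of the last $n_u$ columns of $V$ (those corresponding to the zero columns of $D$). The squared exponential covariance function is $k_{\mathrm{SE}}(t,t')=\sigma_f^2\exp\left(-\frac{(t-t')^2}{2\ell^2}\right)$ with $\sigma_f,\ell>0$. The LODE-GP is the $\mathbb{R}^{n_z}$-valued Gaussian process obtained by applying the operator $V_0$ to a latent Gaussian process with $n_u$ independent components, each with covariance $k_{\mathrm{SE}}$. Its matrix-valued covariance function is $$k(t,t')=V_0(\partial_t)\,\bigl(k_{\mathrm{SE}}(t,t')\,I_{n_u}\bigr)\,V_0(\partial_{t'})^\top\in\mathbb{R}^{n_z\times n_z},$$ where $V_0(\partial_t)$ acts by differentiation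 in the first argument $t$ and $V_0(\partial_{t'})$ by differentiation in the second argument $t'$. Its prior mean $\mu$ is a smooth function satisfying $H\mu=0$ (for instance $\mu=0$, or a constant reference $\mu(t)=z_{\mathrm{ref}}$ with $Hz_{\mathrm{ref}}=0$). *)

theory Defs
  imports "HOL-Analysis.Analysis" "HOL-Computational_Algebra.Polynomial"
begin

text \<open>
  States, controls and stacked vectors \<open>z = (x, u)\<close> are indexed by \<open>'x\<close>, \<open>'u\<close> and \<open>'x + 'u\<close>.
  A real polynomial stands for a differential operator: its indeterminate is \<open>d/dt\<close>.
\<close>

definition diff_op :: "real poly \<Rightarrow> (real \<Rightarrow> real) \<Rightarrow> real \<Rightarrow> real" where
  "diff_op p f t = (\<Sum>i\<le>degree p. coeff p i * (deriv ^^ i) f t)"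

definition diff_op_vec ::
  "real poly ^ 'n::finite ^ 'm::finite \<Rightarrow> (real \<Rightarrow> real ^ 'n) \<Rightarrow> real \<Rightarrow> real ^ 'm" where
  "diff_op_vec M f t = (\<chi> i. \<Sum>j\<in>UNIV. diff_op (M $ i $ j) (\<lambda>s. f s $ j) t)"

text \<open>
  For a matrix-valued kernel \<open>K\<close>: \<open>diff_op_left M K\<close> is \<open>M(d/dt) K(t, t')\<close>, with differentiation
  in the first argument, and \<open>diff_op_right K M\<close> is \<open>K(t, t') M(d/dt')\<^sup>T\<close>, with
  differentiation in the second argument.
\<close>

definition diff_op_left ::
  "real poly ^ 'n::finite ^ 'm::finite \<Rightarrow> (real \<Rightarrow> real \<Rightarrow> real ^ 'k::finite ^ 'n)
    \<Rightarrow> real \<Rightarrow> real \<Rightarrow> real ^ 'k ^ 'm" where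
  "diff_op_left M K t t' =
    (\<chi> i j. \<Sum>a\<in>UNIV. diff_op (M $ i $ a) (\<lambda>s. K s t' $ a $ j) t)"

definition diff_op_right ::
  "(real \<Rightarrow> real \<Rightarrow> real ^ 'n::finite ^ 'k::finite) \<Rightarrow> real poly ^ 'n ^ 'm::finite
    \<Rightarrow> real \<Rightarrow> real \<Rightarrow> real ^ 'm ^ 'k" where
  "diff_op_right K M t t' =
    (\<chi> i j. \<Sum>b\<in>UNIV. diff_op (M $ j $ b) (\<lambda>s. K t s $ i $ b) t')"

definition smooth_vec :: "(real \<Rightarrow> real ^ 'n::finite) \<Rightarrow> bool" where
  "smooth_vec f \<longleftrightarrow>
    (\<forall>i n t. (deriv ^^ n) (\<lambda>s. f s $ i) field_differentiable at t)"

text \<open>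
  Controllability is state transfer in finite time with continuous controls. For linear
  time-invariant systems, neither fixing the time \<open>T > 0\<close> in advance nor choosing another usual
  class of controls changes the notion.
\<close>

definition controllable ::
  "real ^ 'x::finite ^ 'x \<Rightarrow> real ^ 'u::finite ^ 'x \<Rightarrow> bool" where
  "controllable A B \<longleftrightarrow>
    (\<forall>x\<^sub>0 x\<^sub>1. \<exists>T>0. \<exists>u x.
      continuous_on {0..T} u \<and>
      (\<forall>t\<in>{0..T}. (x has_vector_derivative (A *v x t + B *v u t)) (at t within {0..T})) \<and>
      x 0 = x\<^sub>0 \<and> x T = x\<^sub>1)"

text \<open>The block matrix \<open>(A - \<partial>\<^sub>t I | B)\<close>.\<close>

definition system_matrix ::
  "real ^ 'x::finite ^ 'x \<Rightarrow> real ^ 'u::finite ^ 'x \<Rightarrow> real poly ^ ('x + 'u) ^ 'x" where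
  "system_matrix A B =
    (\<chi> i j. case j of
        Inl k \<Rightarrow> [:A $ i $ k:] - (if i = k then [:0, 1:] else 0)
      | Inr l \<Rightarrow> [:B $ i $ l:])"

text \<open>The block matrix \<open>(I | 0)\<close>, the Smith normal form of the system matrix of a
  controllable system.\<close>

definition smith_controllable :: "real poly ^ ('x::finite + 'u::finite) ^ 'x" where
  "smith_controllable = (\<chi> i j. case j of Inl k \<Rightarrow> if i = k then 1 else 0 | Inr l \<Rightarrow> 0)"

text \<open>The columns belonging to the zero block of \<open>(I | 0)\<close>.\<close>

definition last_columns ::
  "real poly ^ ('x::finite + 'u::finite) ^ 'm::finite \<Rightarrow> real poly ^ 'u ^ 'm" where
  "last_columns V = (\<chi> i j. V $ i $ Inr j)"

definition se_kernel :: "real \<Rightarrow> real \<Rightarrow> real \<Rightarrow> real \<Rightarrow> real" where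
  "se_kernel \<sigma>\<^sub>f l t t' = \<sigma>\<^sub>f\<^sup>2 * exp (- ((t - t')\<^sup>2 / (2 * l\<^sup>2)))"

definition lode_gp_cov ::
  "real poly ^ 'u::finite ^ 'm::finite \<Rightarrow> real \<Rightarrow> real \<Rightarrow> real \<Rightarrow> real \<Rightarrow> real ^ 'm ^ 'm" where
  "lode_gp_cov V\<^sub>0 \<sigma>\<^sub>f l =
    diff_op_left V\<^sub>0 (diff_op_right (\<lambda>t t'. se_kernel \<sigma>\<^sub>f l t t' *\<^sub>R mat 1) V\<^sub>0)"

text \<open>
  A Gaussian process is represented by its mean function and its covariance function.
  The transformations \<open>Q\<close> and \<open>V\<close> are not unique, so neither is the covariance function of a
  LODE-GP for a given system. Here \<open>invertible\<close> is invertibility over the polynomial ring.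
\<close>

definition lode_gp ::
  "real ^ 'x::finite ^ 'x \<Rightarrow> real ^ 'u::finite ^ 'x \<Rightarrow> real \<Rightarrow> real
    \<Rightarrow> (real \<Rightarrow> real ^ ('x + 'u)) \<Rightarrow> (real \<Rightarrow> real \<Rightarrow> real ^ ('x + 'u) ^ ('x + 'u)) \<Rightarrow> bool" where
  "lode_gp A B \<sigma>\<^sub>f l \<mu> k \<longleftrightarrow>
    smooth_vec \<mu> \<and> (\<forall>t. diff_op_vec (system_matrix A B) \<mu> t = 0) \<and>
    (\<exists>(Q :: real poly ^ 'x ^ 'x) (V :: real poly ^ ('x + 'u) ^ ('x + 'u)).
      invertible Q \<and> invertible V \<and>
      Q ** system_matrix A B ** V = smith_controllable \<and>
      k = lode_gp_cov (last_columns V) \<sigma>\<^sub>f l)"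

text \<open>Posterior mean for the one-point dataset \<open>{(t\<^sub>0, z\<^sub>0)}\<close>; \<open>s\<close> is the noise variance.\<close>

definition posterior_mean ::
  "(real \<Rightarrow> real ^ 'n::finite) \<Rightarrow> (real \<Rightarrow> real \<Rightarrow> real ^ 'n ^ 'n) \<Rightarrow> real
    \<Rightarrow> real \<Rightarrow> real ^ 'n \<Rightarrow> real \<Rightarrow> real ^ 'n" where
  "posterior_mean \<mu> k s t\<^sub>0 z\<^sub>0 t =
    \<mu> t + (k t t\<^sub>0 ** matrix_inv (k t\<^sub>0 t\<^sub>0 + s *\<^sub>R mat 1)) *v (z\<^sub>0 - \<mu> t\<^sub>0)"

end

theory Submission
  imports Defs "HOL-Real_Asymp.Real_Asymp"
begin

text \<open>
  The difference of posterior and prior mean is \<open>k(t, t\<^sub>0) *v w\<close> for a vector \<open>w\<close> that is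
  independent of \<open>t\<close>, so everything follows once each entry of \<open>k(t, t\<^sub>0)\<close> vanishes as
  \<open>t \<rightarrow> \<plusminus>\<infinity>\<close>. Each entry is obtained from the squared exponential kernel by applying constant
  coefficient differential operators in either argument. The squared exponential kernel depends
  on \<open>t - t'\<close> only and is a Gaussian in it. The functions of the form polynomial times this
  Gaussian are a vector space closed under differentiation (\<open>poly_gauss_deriv\<close>), and
  differentiating a kernel \<open>f(t - t')\<close> in \<open>t\<close> or \<open>t'\<close> gives, up to sign, \<open>f'(t - t')\<close>
  (\<open>higher_deriv_affine\<close>). Hence each entry of \<open>k(t, t')\<close> is again a polynomial times
  a Gaussian in \<open>t - t'\<close>, and the Gaussian wins against the polynomial
  (\<open>poly_gauss_tendsto_0\<close>).
\<close>

definition poly_gauss :: "real \<Rightarrow> (real \<Rightarrow> real) set" where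
  "poly_gauss a = {f. \<exists>p. f = (\<lambda>t. poly p t * exp (- (a * t\<^sup>2)))}"

lemma poly_gauss_cmult:
  assumes "f \<in> poly_gauss a"
  shows "(\<lambda>t. c * f t) \<in> poly_gauss a"
proof -
  obtain p where "f = (\<lambda>t. poly p t * exp (- (a * t\<^sup>2)))"
    using assms by (auto simp: poly_gauss_def)
  then have "(\<lambda>t. c * f t) = (\<lambda>t. poly (smult c p) t * exp (- (a * t\<^sup>2)))"
    by (simp add: mult.assoc)
  then show ?thesis
    unfolding poly_gauss_def by blast
qed

lemma poly_gauss_sum:
  assumes "\<And>i. i \<in> I \<Longrightarrow> f i \<in> poly_gauss a"
  shows "(\<lambda>t. \<Sum>i\<in>I. f i t) \<in> poly_gauss a"
proof -
  obtain p where p: "\<And>i. i \<in> I \<Longrightarrow> f i = (\<lambda>t. poly (p i) t * exp (- (a * t\<^sup>2)))"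
    using assms unfolding poly_gauss_def by simp metis
  have "(\<lambda>t. \<Sum>i\<in>I. f i t) = (\<lambda>t. poly (\<Sum>i\<in>I. p i) t * exp (- (a * t\<^sup>2)))"
    by (simp add: p poly_sum sum_distrib_right)
  then show ?thesis
    unfolding poly_gauss_def by blast
qed

text \<open>
  The product rule for \<open>p(t) exp(-a t\<^sup>2)\<close> leaves the Gaussian as a common factor, next to the
  polynomial \<open>p' - 2 a t p\<close>.
\<close>

lemma poly_gauss_deriv:
  assumes "f \<in> poly_gauss a"
  shows "\<And>t. (f has_field_derivative deriv f t) (at t)" and "deriv f \<in> poly_gauss a"
proof -
  obtain p where f: "f = (\<lambda>t. poly p t * exp (- (a * t\<^sup>2)))"
    using assms by (auto simp: poly_gauss_def)
  define q where "q = pderiv p - [:0, 2 * a:] * p"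
  have D: "(f has_field_derivative poly q t * exp (- (a * t\<^sup>2))) (at t)" for t
    unfolding f q_def
    by (auto intro!: derivative_eq_intros simp: algebra_simps power2_eq_square)
  then have deriv_f: "deriv f = (\<lambda>t. poly q t * exp (- (a * t\<^sup>2)))"
    by (intro ext DERIV_imp_deriv)
  show "(f has_field_derivative deriv f t) (at t)" for t
    using D by (simp add: deriv_f)
  show "deriv f \<in> poly_gauss a"
    unfolding deriv_f poly_gauss_def by blast
qed

lemma poly_gauss_higher_deriv:
  assumes "f \<in> poly_gauss a"
  shows "(deriv ^^ n) f \<in> poly_gauss a"
  using assms by (induction n) (auto intro: poly_gauss_deriv(2))

text \<open>
  With \<open>c = 1\<close> and \<open>c = -1\<close> this covers differentiation of a kernel \<open>f(t - t')\<close> in its first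
  and in its second argument.
\<close>

lemma higher_deriv_affine:
  assumes "f \<in> poly_gauss a"
  shows "(deriv ^^ n) (\<lambda>s. f (c * s + b)) = (\<lambda>s. c ^ n * (deriv ^^ n) f (c * s + b))"
proof (induction n)
  case 0
  show ?case by simp
next
  case (Suc n)
  let ?g = "(deriv ^^ n) f"
  have g: "(?g has_field_derivative deriv ?g t) (at t)" for t
    using assms by (intro poly_gauss_deriv(1) poly_gauss_higher_deriv)
  have "((\<lambda>s. c ^ n * ?g (c * s + b)) has_field_derivative
      c ^ Suc n * deriv ?g (c * s + b)) (at s)" for s
    by (auto intro!: derivative_eq_intros DERIV_chain2[OF g])
  then have "deriv (\<lambda>s. c ^ n * ?g (c * s + b)) = (\<lambda>s. c ^ Suc n * deriv ?g (c * s + b))"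
    by (intro ext DERIV_imp_deriv)
  then show ?case
    by (simp add: Suc.IH)
qed

text \<open>
  The witness \<open>h\<close> is chosen before \<open>b\<close> and \<open>s\<close>: the shift \<open>b\<close> will be the other argument of a
  kernel, and the result must again be a function of the difference of both arguments.
\<close>

lemma diff_op_affine:
  assumes "f \<in> poly_gauss a"
  obtains h where "h \<in> poly_gauss a"
    and "\<And>b s. diff_op p (\<lambda>s. f (c * s + b)) s = h (c * s + b)"
proof
  let ?h = "\<lambda>y. \<Sum>i\<le>degree p. coeff p i * (c ^ i * (deriv ^^ i) f y)"
  show "?h \<in> poly_gauss a"
    by (intro poly_gauss_sum poly_gauss_cmult poly_gauss_higher_deriv assms)
  show "diff_op p (\<lambda>s. f (c * s + b)) s = ?h (c * s + b)" for b s
    by (simp add: diff_op_def higher_deriv_affine[OF assms])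
qed

definition poly_gauss_kernel ::
  "real \<Rightarrow> (real \<Rightarrow> real \<Rightarrow> real ^ 'n::finite ^ 'm::finite) \<Rightarrow> bool" where
  "poly_gauss_kernel a K \<longleftrightarrow>
    (\<forall>i j. \<exists>f\<in>poly_gauss a. \<forall>t t'. K t t' $ i $ j = f (t - t'))"

lemma poly_gauss_kernelI:
  assumes "\<And>i j. f i j \<in> poly_gauss a"
    and "\<And>t t' i j. K t t' $ i $ j = f i j (t - t')"
  shows "poly_gauss_kernel a K"
  using assms unfolding poly_gauss_kernel_def by metis

lemma poly_gauss_kernelE:
  assumes "poly_gauss_kernel a K"
  obtains f where "\<And>i j. f i j \<in> poly_gauss a"
    and "\<And>t t' i j. K t t' $ i $ j = f i j (t - t')"
  using assms unfolding poly_gauss_kernel_def by metis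

lemma poly_gauss_kernel_diff_op_left:
  assumes "poly_gauss_kernel a K"
  shows "poly_gauss_kernel a (diff_op_left M K)"
proof -
  obtain f where f: "\<And>i j. f i j \<in> poly_gauss a"
    and K: "\<And>t t' i j. K t t' $ i $ j = f i j (t - t')"
    using assms by (rule poly_gauss_kernelE) blast
  have "\<exists>h\<in>poly_gauss a. \<forall>b s. diff_op p (\<lambda>s. f i j (1 * s + b)) s = h (1 * s + b)" for p i j
    using diff_op_affine[OF f] by metis
  then obtain h where h: "\<And>p i j. h p i j \<in> poly_gauss a"
    and diff_f: "\<And>p i j b s. diff_op p (\<lambda>s. f i j (1 * s + b)) s = h p i j (1 * s + b)"
    by metis
  have "diff_op_left M K t t' $ i $ j = (\<Sum>c\<in>UNIV. h (M $ i $ c) c j (t - t'))" for t t' i j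
    using diff_f[where b = "- t'"] by (simp add: diff_op_left_def K)
  moreover have "(\<lambda>y. \<Sum>c\<in>UNIV. h (M $ i $ c) c j y) \<in> poly_gauss a" for i j
    by (intro poly_gauss_sum h)
  ultimately show ?thesis
    by (rule poly_gauss_kernelI[rotated])
qed

lemma poly_gauss_kernel_diff_op_right:
  assumes "poly_gauss_kernel a K"
  shows "poly_gauss_kernel a (diff_op_right K M)"
proof -
  obtain f where f: "\<And>i j. f i j \<in> poly_gauss a"
    and K: "\<And>t t' i j. K t t' $ i $ j = f i j (t - t')"
    using assms by (rule poly_gauss_kernelE) blast
  have "\<exists>h\<in>poly_gauss a. \<forall>b s. diff_op p (\<lambda>s. f i j (- 1 * s + b)) s = h (- 1 * s + b)" for p i j
    using diff_op_affine[OF f] by metis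
  then obtain h where h: "\<And>p i j. h p i j \<in> poly_gauss a"
    and diff_f: "\<And>p i j b s. diff_op p (\<lambda>s. f i j (- 1 * s + b)) s = h p i j (- 1 * s + b)"
    by metis
  have "diff_op_right K M t t' $ i $ j = (\<Sum>c\<in>UNIV. h (M $ j $ c) i c (t - t'))" for t t' i j
    using diff_f[where b = t] by (simp add: diff_op_right_def K)
  moreover have "(\<lambda>y. \<Sum>c\<in>UNIV. h (M $ j $ c) i c y) \<in> poly_gauss a" for i j
    by (intro poly_gauss_sum h)
  ultimately show ?thesis
    by (rule poly_gauss_kernelI[rotated])
qed

lemma poly_gauss_kernel_se:
  "poly_gauss_kernel (1 / (2 * l\<^sup>2)) (\<lambda>t t'. se_kernel \<sigma>\<^sub>f l t t' *\<^sub>R mat 1)"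
proof (rule poly_gauss_kernelI)
  let ?p = "\<lambda>i j. [:\<sigma>\<^sub>f\<^sup>2 * (if i = j then 1 else 0):]"
  let ?f = "\<lambda>i j t. poly (?p i j) t * exp (- (1 / (2 * l\<^sup>2) * t\<^sup>2))"
  show "?f i j \<in> poly_gauss (1 / (2 * l\<^sup>2))" for i j
    unfolding poly_gauss_def by blast
  show "(se_kernel \<sigma>\<^sub>f l t t' *\<^sub>R mat 1) $ i $ j = ?f i j (t - t')" for t t' i j
    by (simp add: se_kernel_def mat_def)
qed

text \<open>
  The limit at \<open>-\<infinity>\<close> reduces to the one at \<open>\<infinity>\<close> monomial by monomial, as the Gaussian is even
  and a reflection changes \<open>t ^ i\<close> by a sign only.
\<close>

lemma poly_gauss_tendsto_0:
  assumes "f \<in> poly_gauss a" and "a > 0"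
  shows "(f \<longlongrightarrow> 0) at_top" and "(f \<longlongrightarrow> 0) at_bot"
proof -
  obtain p where f: "f = (\<lambda>t. \<Sum>i\<le>degree p. coeff p i * (t ^ i * exp (- (a * t\<^sup>2))))"
    using assms(1) by (auto simp: poly_gauss_def poly_altdef sum_distrib_right mult.assoc)
  have top: "((\<lambda>t::real. t ^ i * exp (- (a * t\<^sup>2))) \<longlongrightarrow> 0) at_top" for i :: nat
    using \<open>a > 0\<close> by real_asymp
  have bot: "((\<lambda>t::real. t ^ i * exp (- (a * t\<^sup>2))) \<longlongrightarrow> 0) at_bot" for i :: nat
  proof -
    have "(- t) ^ i * exp (- (a * (- t)\<^sup>2)) = (- 1) ^ i * (t ^ i * exp (- (a * t\<^sup>2)))" for t :: real
      by (subst power_minus) (simp add: mult.assoc)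
    then show ?thesis
      unfolding filterlim_at_bot_mirror using tendsto_mult_right_zero[OF top] by presburger
  qed
  show "(f \<longlongrightarrow> 0) at_top"
    unfolding f by (intro tendsto_null_sum tendsto_mult_right_zero top)
  show "(f \<longlongrightarrow> 0) at_bot"
    unfolding f by (intro tendsto_null_sum tendsto_mult_right_zero bot)
qed

lemma poly_gauss_kernel_tendsto_0:
  assumes "poly_gauss_kernel a K" and "a > 0"
  shows "((\<lambda>t. K t t' *v w) \<longlongrightarrow> 0) at_top" and "((\<lambda>t. K t t' *v w) \<longlongrightarrow> 0) at_bot"
proof -
  obtain f where f: "\<And>i j. f i j \<in> poly_gauss a"
    and K: "\<And>t t' i j. K t t' $ i $ j = f i j (t - t')"
    using assms(1) by (rule poly_gauss_kernelE) blast
  have top: "((\<lambda>t. K t t' $ i $ j) \<longlongrightarrow> 0) at_top" for i j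
  proof -
    have "filterlim (\<lambda>t. t - t') at_top at_top"
      by real_asymp
    then show ?thesis
      unfolding K by (rule filterlim_compose[OF poly_gauss_tendsto_0(1)[OF f \<open>a > 0\<close>]])
  qed
  have bot: "((\<lambda>t. K t t' $ i $ j) \<longlongrightarrow> 0) at_bot" for i j
  proof -
    have "filterlim (\<lambda>t. t - t') at_bot at_bot"
      by real_asymp
    then show ?thesis
      unfolding K by (rule filterlim_compose[OF poly_gauss_tendsto_0(2)[OF f \<open>a > 0\<close>]])
  qed
  show "((\<lambda>t. K t t' *v w) \<longlongrightarrow> 0) at_top"
    by (rule vec_tendstoI)
      (auto simp: matrix_vector_mult_def intro!: tendsto_null_sum tendsto_mult_left_zero top)
  show "((\<lambda>t. K t t' *v w) \<longlongrightarrow> 0) at_bot"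
    by (rule vec_tendstoI)
      (auto simp: matrix_vector_mult_def intro!: tendsto_null_sum tendsto_mult_left_zero bot)
qed

theorem theorem1:
  fixes A :: "real ^ 'x::finite ^ 'x" and B :: "real ^ 'u::finite ^ 'x"
    and \<sigma>\<^sub>f l noise_var t\<^sub>0 :: real
    and \<mu> :: "real \<Rightarrow> real ^ ('x + 'u)"
    and k :: "real \<Rightarrow> real \<Rightarrow> real ^ ('x + 'u) ^ ('x + 'u)"
    and z\<^sub>0 :: "real ^ ('x + 'u)"
  assumes "controllable A B"
    and "\<sigma>\<^sub>f > 0" and "l > 0"
    and "lode_gp A B \<sigma>\<^sub>f l \<mu> k"
    and "noise_var \<ge> 0"
  shows "((\<lambda>t. posterior_mean \<mu> k noise_var t\<^sub>0 z\<^sub>0 t - \<mu> t) \<longlongrightarrow> 0) at_top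
    \<and> ((\<lambda>t. posterior_mean \<mu> k noise_var t\<^sub>0 z\<^sub>0 t - \<mu> t) \<longlongrightarrow> 0) at_bot"
proof -
  have kernel: "poly_gauss_kernel (1 / (2 * l\<^sup>2)) k"
    using assms(4) unfolding lode_gp_def lode_gp_cov_def
    by (auto intro: poly_gauss_kernel_diff_op_left poly_gauss_kernel_diff_op_right
        poly_gauss_kernel_se)
  have "1 / (2 * l\<^sup>2) > 0"
    using \<open>l > 0\<close> by simp
  \<comment> \<open>For vanishing noise the covariance matrix at \<open>t\<^sub>0\<close> may be singular; its
    \<open>matrix_inv\<close> is then some unspecified matrix, but still one that is constant in \<open>t\<close>.\<close>
  moreover have "posterior_mean \<mu> k noise_var t\<^sub>0 z\<^sub>0 t - \<mu> t =
      k t t\<^sub>0 *v (matrix_inv (k t\<^sub>0 t\<^sub>0 + noise_var *\<^sub>R mat 1) *v (z\<^sub>0 - \<mu> t\<^sub>0))" for t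
    by (simp add: posterior_mean_def matrix_vector_mul_assoc)
  ultimately show ?thesis
    using poly_gauss_kernel_tendsto_0[OF kernel] by simp
qed

end
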